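(* Let $n\geq 2$ and $D(a)=\{z\in\mathbb{C}^n: ||z_k|^2-|z_n|^2|<(|z_n|^2+1)^{-a}\text{ for } k=1,\ldots,n-1\}$. If $\frac{2}{n-1}<a\leq\frac{3}{n-1}$, then every holomorphic automorphism $\varphi\in\mathrm{Aut}(D(a))$ is linear.
   Context: $\mathrm{Aut}(\Omega)$ denotes the group of biholomorphic self-maps of a domain $\Omega$. *)

theory Defs
  imports "HOL-Analysis.Analysis"
begin

text \<open>Points of C^n are vectors of type complex^'n with n = CARD('n).
  The distinguished coordinate z_n of the paper is an index m :: 'n.\<close>

definition Dom :: "real \<Rightarrow> 'n::finite \<Rightarrow> (complex^'n) set" where
  "Dom a m = {z. \<forall>k. k \<noteq> m \<longrightarrow>
      \<bar>(cmod (z $ k))\<^sup>2 - (cmod (z $ m))\<^sup>2\<bar> < ((cmod (z $ m))\<^sup>2 + 1) powr (- a)}"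

definition holo_Cn :: "(complex^'n::finite \<Rightarrow> complex^'n) \<Rightarrow> (complex^'n) set \<Rightarrow> bool" where
  "holo_Cn f S \<longleftrightarrow> (\<forall>z\<in>S. \<exists>L. (f has_derivative L) (at z)
      \<and> (\<forall>c v. L (c *s v) = c *s L v))"

definition Aut :: "(complex^'n::finite) set \<Rightarrow> (complex^'n \<Rightarrow> complex^'n) set" where
  "Aut S = {f. holo_Cn f S \<and> bij_betw f S S \<and>
      (\<exists>g. holo_Cn g S \<and> (\<forall>z\<in>S. g (f z) = z \<and> f (g z) = z))}"

end

theory Submission
  imports Defs "HOL-Complex_Analysis.Conformal_Mappings"
    "HOL-Computational_Algebra.Fundamental_Theorem_Algebra"
begin

text \<open>The domain contains the complex lines through the origin spanned by vectors all of whose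
  coordinates have modulus one. On such a line the components \<open>f, g\<close> of an automorphism are entire
  functions for which \<open>|f|\<^sup>2 - |g|\<^sup>2\<close> decays like a negative power of
  \<open>T = 1 + |f|\<^sup>2 + |g|\<^sup>2\<close>. A strictly plurisubharmonic weight near the cone \<open>|z| = |w|\<close>, together
  with an Ahlfors--Schwarz argument on discs of growing radius, forces their Wronskian to vanish.
  Hence an automorphism maps these lines onto lines of the same kind, bijectively and so affinely.
  Since distinct lines have distinct images, it fixes the origin, and therefore agrees with its
  differential at the origin on all these lines; by the maximum principle in each coordinate it does so on a
  polydisc, and by analytic continuation along complex lines on the whole balanced domain.\<close>

section \<open>Second-order jets of real functions at 0\<close>

text \<open>The witness \<open>q\<close> is the first derivative near 0. Mere differentiability of
  \<open>q\<close> at 0 suffices for the second-derivative test and is stable under products and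
  composition.\<close>

definition jet2 :: "(real \<Rightarrow> real) \<Rightarrow> real \<Rightarrow> real \<Rightarrow> bool" where
  "jet2 p p1 p2 \<longleftrightarrow> (\<exists>q. (\<forall>\<^sub>F t in nhds 0. (p has_real_derivative q t) (at t)) \<and>
     q 0 = p1 \<and> (q has_real_derivative p2) (at 0))"

lemma jet2_cong: "jet2 p p1 p2 \<Longrightarrow> p1 = q1 \<Longrightarrow> p2 = q2 \<Longrightarrow> jet2 p q1 q2"
  by simp

lemma jet2_add:
  assumes "jet2 p p1 p2" "jet2 q q1 q2"
  shows "jet2 (\<lambda>t. p t + q t) (p1 + q1) (p2 + q2)"
proof -
  obtain P where P: "\<forall>\<^sub>F t in nhds 0. (p has_real_derivative P t) (at t)" "P 0 = p1"
      "(P has_real_derivative p2) (at 0)"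
    using assms(1) by (auto simp: jet2_def)
  obtain Q where Q: "\<forall>\<^sub>F t in nhds 0. (q has_real_derivative Q t) (at t)" "Q 0 = q1"
      "(Q has_real_derivative q2) (at 0)"
    using assms(2) by (auto simp: jet2_def)
  have "\<forall>\<^sub>F t in nhds 0. ((\<lambda>t. p t + q t) has_real_derivative P t + Q t) (at t)"
    using P(1) Q(1) by eventually_elim (rule DERIV_add)
  then show ?thesis
    unfolding jet2_def using P Q DERIV_add by (intro exI[of _ "\<lambda>t. P t + Q t"]) auto
qed

lemma jet2_mult:
  assumes "jet2 p p1 p2" "jet2 q q1 q2"
  shows "jet2 (\<lambda>t. p t * q t) (p1 * q 0 + p 0 * q1) (p2 * q 0 + 2 * p1 * q1 + p 0 * q2)"
proof -
  obtain P where P: "\<forall>\<^sub>F t in nhds 0. (p has_real_derivative P t) (at t)" "P 0 = p1"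
      "(P has_real_derivative p2) (at 0)"
    using assms(1) by (auto simp: jet2_def)
  obtain Q where Q: "\<forall>\<^sub>F t in nhds 0. (q has_real_derivative Q t) (at t)" "Q 0 = q1"
      "(Q has_real_derivative q2) (at 0)"
    using assms(2) by (auto simp: jet2_def)
  have p0: "(p has_real_derivative p1) (at 0)" and q0: "(q has_real_derivative q1) (at 0)"
    using eventually_nhds_x_imp_x[OF P(1)] eventually_nhds_x_imp_x[OF Q(1)] P(2) Q(2) by auto
  have "\<forall>\<^sub>F t in nhds 0. ((\<lambda>t. p t * q t) has_real_derivative P t * q t + p t * Q t) (at t)"
    using P(1) Q(1) by eventually_elim (auto intro!: derivative_eq_intros)
  moreover have "((\<lambda>t. P t * q t + p t * Q t) has_real_derivative
      p2 * q 0 + 2 * p1 * q1 + p 0 * q2) (at 0)"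
    by (rule DERIV_cong[OF DERIV_add[OF DERIV_mult[OF P(3) q0] DERIV_mult[OF p0 Q(3)]]])
      (simp add: P(2) Q(2) algebra_simps)
  ultimately show ?thesis
    unfolding jet2_def using P(2) Q(2)
    by (intro exI[of _ "\<lambda>t. P t * q t + p t * Q t"]) auto
qed

text \<open>The outer function \<open>h\<close> is constrained only near \<open>p 0\<close>, so that
  \<open>ln\<close> at a positive value is covered.\<close>

lemma jet2_compose:
  assumes "jet2 p p1 p2"
    and h: "\<forall>\<^sub>F y in nhds (p 0). (h has_real_derivative h1 y) (at y)"
      "(h1 has_real_derivative h2) (at (p 0))"
  shows "jet2 (\<lambda>t. h (p t)) (h1 (p 0) * p1) (h2 * p1\<^sup>2 + h1 (p 0) * p2)"
proof -
  obtain P where P: "\<forall>\<^sub>F t in nhds 0. (p has_real_derivative P t) (at t)" "P 0 = p1"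
      "(P has_real_derivative p2) (at 0)"
    using assms(1) by (auto simp: jet2_def)
  have p0: "(p has_real_derivative p1) (at 0)"
    using eventually_nhds_x_imp_x[OF P(1)] P(2) by auto
  have "filterlim p (nhds (p 0)) (nhds 0)"
    using DERIV_isCont[OF p0] by (simp add: isCont_def tendsto_at_iff_tendsto_nhds)
  from eventually_compose_filterlim[OF h(1) this] P(1)
  have "\<forall>\<^sub>F t in nhds 0. ((\<lambda>t. h (p t)) has_real_derivative h1 (p t) * P t) (at t)"
    by eventually_elim (rule DERIV_chain2)
  moreover have "((\<lambda>t. h1 (p t)) has_real_derivative h2 * p1) (at 0)"
    by (rule DERIV_chain2[OF h(2) p0])
  then have "((\<lambda>t. h1 (p t) * P t) has_real_derivative h2 * p1\<^sup>2 + h1 (p 0) * p2) (at 0)"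
    by (rule DERIV_cong[OF DERIV_mult[OF _ P(3)]]) (simp add: P(2) power2_eq_square algebra_simps)
  ultimately show ?thesis
    unfolding jet2_def using P(2)
    by (intro exI[of _ "\<lambda>t. h1 (p t) * P t"]) auto
qed

text \<open>If \<open>p2\<close> were positive, the derivative, which vanishes at the maximum, would
  be positive just to the right of 0, and \<open>p\<close> would increase strictly there.\<close>

lemma jet2_local_max:
  assumes "jet2 p p1 p2" and max: "\<forall>\<^sub>F t in nhds 0. p t \<le> p 0"
  shows "p2 \<le> 0"
proof (rule ccontr)
  assume "\<not> p2 \<le> 0"
  then have pos: "0 < p2" by simp
  obtain P where P: "\<forall>\<^sub>F t in nhds 0. (p has_real_derivative P t) (at t)" "P 0 = p1"
      "(P has_real_derivative p2) (at 0)"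
    using assms(1) by (auto simp: jet2_def)
  obtain d1 where d1: "d1 > 0" "\<And>t. \<bar>t\<bar> < d1 \<Longrightarrow> (p has_real_derivative P t) (at t) \<and> p t \<le> p 0"
    using eventually_conj[OF P(1) max] by (auto simp: eventually_nhds_metric dist_real_def)
  have "P 0 = 0"
    by (rule DERIV_local_max[of p _ 0 d1]) (use d1 in auto)
  moreover obtain d2 where d2: "d2 > 0" "\<And>h. 0 < h \<Longrightarrow> h < d2 \<Longrightarrow> P 0 < P (0 + h)"
    using DERIV_pos_inc_right[OF P(3) pos] by auto
  define h where "h = min d1 d2 / 2"
  have h: "0 < h" "h < d1" "h < d2" using d1 d2 by (auto simp: h_def)
  have "p 0 < p h"
    by (rule DERIV_pos_imp_increasing_open[OF h(1)])
      (use h d1 d2 calculation in \<open>force intro!: continuous_at_imp_continuous_on DERIV_isCont\<close>)+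
  with d1(2)[of h] h show False by auto
qed

section \<open>Levi forms of real functions on the complex plane\<close>

text \<open>Second-order data of a real function of a complex variable: \<open>g\<close> is its Wirtinger
  derivative \<open>\<partial>f/\<partial>z\<close> and \<open>l\<close> its Levi form, a quarter of the Laplacian.\<close>

definition levi :: "(complex \<Rightarrow> real) \<Rightarrow> complex \<Rightarrow> complex \<Rightarrow> real \<Rightarrow> bool" where
  "levi f z g l \<longleftrightarrow> (\<exists>s1 s2. jet2 (\<lambda>t. f (z + of_real t)) (2 * Re g) s1 \<and>
     jet2 (\<lambda>t. f (z + of_real t * \<i>)) (- 2 * Im g) s2 \<and> s1 + s2 = 4 * l)"

lemma levi_cong: "levi f z g l \<Longrightarrow> g = g' \<Longrightarrow> l = l' \<Longrightarrow> levi f z g' l'"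
  by simp

lemma levi_add:
  assumes "levi f z g l" "levi f' z g' l'"
  shows "levi (\<lambda>z. f z + f' z) z (g + g') (l + l')"
proof -
  obtain s1 s2 t1 t2 where
    "jet2 (\<lambda>t. f (z + of_real t)) (2 * Re g) s1" "jet2 (\<lambda>t. f (z + of_real t * \<i>)) (- 2 * Im g) s2"
    "jet2 (\<lambda>t. f' (z + of_real t)) (2 * Re g') t1" "jet2 (\<lambda>t. f' (z + of_real t * \<i>)) (- 2 * Im g') t2"
    and s: "s1 + s2 = 4 * l" "t1 + t2 = 4 * l'"
    using assms by (auto simp: levi_def)
  from jet2_add[OF this(1,3)] jet2_add[OF this(2,4)] show ?thesis
    unfolding levi_def
    by (intro exI[of _ "s1 + t1"] exI[of _ "s2 + t2"]) (use s in \<open>auto simp: algebra_simps\<close>)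
qed

text \<open>The cross term is the scalar product of the two gradients, which equals
  \<open>4 * Re (g * cnj g')\<close> in Wirtinger terms and occurs twice in the Laplacian.\<close>

lemma levi_mult:
  assumes "levi f z g l" "levi f' z g' l'"
  shows "levi (\<lambda>z. f z * f' z) z (g * of_real (f' z) + of_real (f z) * g')
    (l * f' z + 2 * Re (g * cnj g') + f z * l')"
proof -
  obtain s1 s2 t1 t2 where
    j: "jet2 (\<lambda>t. f (z + of_real t)) (2 * Re g) s1" "jet2 (\<lambda>t. f (z + of_real t * \<i>)) (- 2 * Im g) s2"
    "jet2 (\<lambda>t. f' (z + of_real t)) (2 * Re g') t1" "jet2 (\<lambda>t. f' (z + of_real t * \<i>)) (- 2 * Im g') t2"
    and "s1 + s2 = 4 * l" "t1 + t2 = 4 * l'"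
    using assms by (auto simp: levi_def)
  then have s: "s1 = 4 * l - s2" "t1 = 4 * l' - t2" by simp_all
  show ?thesis
    unfolding levi_def
    apply (intro exI conjI)
      apply (rule jet2_cong[OF jet2_mult[OF j(1,3)] _ refl], simp add: algebra_simps)
     apply (rule jet2_cong[OF jet2_mult[OF j(2,4)] _ refl], simp add: algebra_simps)
    apply (simp add: s algebra_simps)
    done
qed

lemma levi_compose:
  assumes "levi f z g l"
    and h: "\<forall>\<^sub>F y in nhds (f z). (h has_real_derivative h1 y) (at y)"
      "(h1 has_real_derivative h2) (at (f z))"
  shows "levi (\<lambda>z. h (f z)) z (of_real (h1 (f z)) * g) (h2 * (cmod g)\<^sup>2 + h1 (f z) * l)"
proof -
  obtain s1 s2 where
    j: "jet2 (\<lambda>t. f (z + of_real t)) (2 * Re g) s1" "jet2 (\<lambda>t. f (z + of_real t * \<i>)) (- 2 * Im g) s2"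
    and "s1 + s2 = 4 * l"
    using assms by (auto simp: levi_def)
  then have s: "s1 = 4 * l - s2" by simp
  show ?thesis
    unfolding levi_def
    apply (intro exI conjI)
      apply (rule jet2_cong[OF jet2_compose[OF j(1), of h h1 h2] _ refl])
        apply (use h in \<open>simp_all add: algebra_simps\<close>)[3]
     apply (rule jet2_cong[OF jet2_compose[OF j(2), of h h1 h2] _ refl])
       apply (use h in \<open>simp_all add: algebra_simps\<close>)[3]
    apply (simp add: s cmod_power2 algebra_simps power_mult_distrib)
    done
qed

lemma levi_const: "levi (\<lambda>z. c) z 0 0"
proof -
  have "jet2 (\<lambda>t. c) 0 0"
    unfolding jet2_def by (intro exI[of _ "\<lambda>t. 0"]) auto
  then show ?thesis unfolding levi_def by (intro exI[of _ 0]) auto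
qed

lemma levi_cmult:
  assumes "levi f z g l"
  shows "levi (\<lambda>z. c * f z) z (of_real c * g) (c * l)"
  using levi_mult[OF levi_const[of c z] assms] by simp

lemma levi_diff:
  assumes "levi f z g l" "levi f' z g' l'"
  shows "levi (\<lambda>z. f z - f' z) z (g - g') (l - l')"
  using levi_add[OF assms(1) levi_cmult[OF assms(2), of "-1"]] by simp

lemma jet2_Re:
  fixes F F' :: "complex \<Rightarrow> complex"
  assumes F: "\<And>w. (F has_field_derivative F' w) (at w)" and F': "(F' has_field_derivative F2) (at z)"
  shows "jet2 (\<lambda>t. Re (F (z + of_real t * d))) (Re (d * F' z)) (Re (d\<^sup>2 * F2))"
    and "jet2 (\<lambda>t. Im (F (z + of_real t * d))) (Im (d * F' z)) (Im (d\<^sup>2 * F2))"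
proof -
  have lin: "((\<lambda>t. z + of_real t * d) has_vector_derivative d) (at t)" for t
    by (auto intro!: derivative_eq_intros)
  have 1: "((\<lambda>t. F (z + of_real t * d)) has_vector_derivative d * F' (z + of_real t * d)) (at t)" for t
    using field_vector_diff_chain_at[OF lin F] by (simp add: o_def)
  have "((\<lambda>t. F' (z + of_real t * d)) has_vector_derivative d * F2) (at 0)"
    using field_vector_diff_chain_at[OF lin[of 0], of F' F2] F' by (simp add: o_def)
  from has_vector_derivative_mult_right[OF this, of d]
  have 2: "((\<lambda>t. d * F' (z + of_real t * d)) has_vector_derivative d\<^sup>2 * F2) (at 0)"
    by (simp add: power2_eq_square mult.assoc)
  show "jet2 (\<lambda>t. Re (F (z + of_real t * d))) (Re (d * F' z)) (Re (d\<^sup>2 * F2))"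
    unfolding jet2_def
    by (intro exI[of _ "\<lambda>t. Re (d * F' (z + of_real t * d))"] conjI always_eventually allI)
      (use bounded_linear.has_vector_derivative[OF bounded_linear_Re 1] bounded_linear.has_vector_derivative[OF bounded_linear_Re 2]
        in \<open>auto simp: has_real_derivative_iff_has_vector_derivative\<close>)
  show "jet2 (\<lambda>t. Im (F (z + of_real t * d))) (Im (d * F' z)) (Im (d\<^sup>2 * F2))"
    unfolding jet2_def
    by (intro exI[of _ "\<lambda>t. Im (d * F' (z + of_real t * d))"] conjI always_eventually allI)
      (use bounded_linear.has_vector_derivative[OF bounded_linear_Im 1] bounded_linear.has_vector_derivative[OF bounded_linear_Im 2]
        in \<open>auto simp: has_real_derivative_iff_has_vector_derivative\<close>)
qed

text \<open>Real and imaginary parts of a holomorphic function are harmonic: the second derivatives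
  along 1 and \<open>\<i>\<close> come from \<open>F2\<close> and \<open>\<i>\<^sup>2 * F2\<close>,
  which cancel.\<close>

lemma levi_Re:
  assumes "\<And>w. (F has_field_derivative F' w) (at w)" "(F' has_field_derivative F2) (at z)"
  shows "levi (\<lambda>z. Re (F z)) z (F' z / 2) 0"
    and "levi (\<lambda>z. Im (F z)) z (F' z / (2 * \<i>)) 0"
  using jet2_Re[OF assms, of 1] jet2_Re[OF assms, of \<i>]
  unfolding levi_def
   apply -
   apply (rule exI[of _ "Re F2"], rule exI[of _ "- Re F2"], simp)
  apply (rule exI[of _ "Im F2"], rule exI[of _ "- Im F2"], simp)
  done

text \<open>The squared modulus is a sum of squares of two harmonic functions, so only the gradient
  terms of the product rule survive in the Levi form.\<close>

lemma levi_norm_squared: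
  assumes "F holomorphic_on UNIV"
  shows "levi (\<lambda>z. (cmod (F z))\<^sup>2) z (deriv F z * cnj (F z)) ((cmod (deriv F z))\<^sup>2)"
proof -
  have 1: "(F has_field_derivative deriv F w) (at w)" for w
    using assms holomorphic_derivI by blast
  have "deriv F holomorphic_on UNIV" using assms by (simp add: holomorphic_deriv)
  then have 2: "(deriv F has_field_derivative deriv (deriv F) z) (at z)"
    using holomorphic_derivI by blast
  note L = levi_Re[OF 1 2]
  note M = levi_add[OF levi_mult[OF L(1) L(1)] levi_mult[OF L(2) L(2)]]
  show ?thesis
    unfolding cmod_power2
    apply (rule levi_cong[OF M[folded power2_eq_square]])
     apply (simp add: complex_eq_iff Re_divide Im_divide power2_eq_square)
    apply (simp add: Re_divide Im_divide power2_eq_square field_simps)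
    done
qed

lemma levi_local_max:
  assumes "levi f z g l" and "\<forall>\<^sub>F w in nhds z. f w \<le> f z"
  shows "l \<le> 0"
proof -
  obtain s1 s2 where
    j: "jet2 (\<lambda>t. f (z + of_real t)) (2 * Re g) s1" "jet2 (\<lambda>t. f (z + of_real t * \<i>)) (- 2 * Im g) s2"
    and s: "s1 + s2 = 4 * l"
    using assms by (auto simp: levi_def)
  have 1: "\<forall>\<^sub>F t in nhds (0::real). f (z + of_real t * d) \<le> f (z + of_real 0 * d)" for d
  proof -
    have "((\<lambda>t. z + of_real t * d) \<longlongrightarrow> z + of_real 0 * d) (nhds 0)"
      by (intro tendsto_intros) (simp add: filterlim_ident)
    from eventually_compose_filterlim[OF assms(2), of _ "nhds 0"] this show ?thesis by simp
  qed
  have "s1 \<le> 0" by (rule jet2_local_max[OF j(1)]) (use 1[of 1] in simp)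
  moreover have "s2 \<le> 0" by (rule jet2_local_max[OF j(2)]) (use 1[of \<i>] in simp)
  ultimately show ?thesis using s by simp
qed

lemma levi_ln:
  assumes "levi f z g l" "f z > 0"
  shows "levi (\<lambda>z. ln (f z)) z (g / of_real (f z)) (l / f z - (cmod g)\<^sup>2 / (f z)\<^sup>2)"
proof -
  have "\<forall>\<^sub>F y in nhds (f z). (ln has_real_derivative inverse y) (at y)"
    using eventually_nhds_in_open[of "{0<..}" "f z"] assms(2)
    by (auto elim!: eventually_mono intro!: derivative_eq_intros simp: inverse_eq_divide)
  moreover have "(inverse has_real_derivative - inverse ((f z)\<^sup>2)) (at (f z))"
    using assms(2) DERIV_inverse[of "f z"] by (simp add: numeral_2_eq_2)
  ultimately show ?thesis
    using levi_compose[OF assms(1), of ln inverse "- inverse ((f z)\<^sup>2)"]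
    by (simp add: field_simps)
qed

lemma levi_exp:
  assumes "levi f z g l"
  shows "levi (\<lambda>z. exp (f z)) z (of_real (exp (f z)) * g) (exp (f z) * ((cmod g)\<^sup>2 + l))"
proof -
  show ?thesis
    using levi_compose[OF assms(1), of exp exp "exp (f z)"]
    by (auto simp: algebra_simps)
qed

section \<open>The Ahlfors--Schwarz argument on growing discs\<close>

text \<open>Off the zeros of \<open>W\<close> the function \<open>ln |W|^2\<close> is harmonic, so
  \<open>|W|^2 e^\<rho>\<close> is the density of a metric whose curvature is bounded above by a
  negative constant. Comparison with the Poincare metric of a disc of radius \<open>R\<close> bounds
  this density at the centre by a multiple of \<open>1 / R^2\<close>, for every
  \<open>R\<close>.\<close>

lemma Ahlfors_vanishing:
  assumes W: "W holomorphic_on UNIV" and \<rho>: "continuous_on UNIV \<rho>" and "c > 0"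
    and curv: "\<And>z. \<exists>g l. levi \<rho> z g l \<and> c * ((cmod (W z))\<^sup>2 * exp (\<rho> z)) \<le> l"
  shows "W z0 = 0"
proof (rule ccontr)
  assume W0: "W z0 \<noteq> 0"
  define H where "H z = (cmod (W z))\<^sup>2 * exp (\<rho> z)" for z
  have H0: "H z0 > 0" using W0 by (simp add: H_def)
  have bound: "c * H z0 * R\<^sup>2 \<le> 2" if R: "R > 0" for R :: real
  proof -
    \<comment> \<open>The Poincare density of the disc is a multiple of \<open>R^2 / q^2\<close>, so
      \<open>H q^2\<close> is the quotient of the two metrics up to a constant. Since
      \<open>q\<close> vanishes on the boundary circle, its maximum is attained inside.\<close>
    define q where "q z = R\<^sup>2 - (cmod (z - z0))\<^sup>2" for z
    have contW: "continuous_on UNIV W" using W holomorphic_on_imp_continuous_on by blast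
    have "continuous_on (cball z0 R) (\<lambda>z. H z * (q z)\<^sup>2)"
      unfolding H_def q_def
      by (intro continuous_intros continuous_on_subset[OF contW] continuous_on_subset[OF \<rho>]) auto
    then obtain z where z: "z \<in> cball z0 R" "\<And>w. w \<in> cball z0 R \<Longrightarrow> H w * (q w)\<^sup>2 \<le> H z * (q z)\<^sup>2"
      using continuous_attains_sup[of "cball z0 R" "\<lambda>z. H z * (q z)\<^sup>2"] R
      by (metis cball_eq_empty compact_cball not_less_iff_gr_or_eq)
    have at0: "H z0 * R ^ 4 \<le> H z * (q z)\<^sup>2"
      using z(2)[of z0] R by (simp add: q_def power_mult[symmetric])
    with H0 R have pos: "0 < H z * (q z)\<^sup>2"
      by (smt (verit) mult_pos_pos zero_less_power)
    then have Wz: "W z \<noteq> 0" and "q z \<noteq> 0" by (auto simp: H_def)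
    with z(1) have zin: "z \<in> ball z0 R" and qz: "q z > 0"
      by (auto simp: q_def dist_norm norm_minus_commute less_le power_mono)
    obtain g l where gl: "levi \<rho> z g l" "c * H z \<le> l" using curv[of z] by (auto simp: H_def)
    have hq: "(\<lambda>z. z - z0) holomorphic_on UNIV" by (intro holomorphic_intros)
    have dq: "deriv (\<lambda>z. z - z0) z = 1" by (rule DERIV_imp_deriv) (auto intro!: derivative_eq_intros)
    have "levi q z (- cnj (z - z0)) (- 1)"
      using levi_diff[OF levi_const[of "R\<^sup>2"] levi_norm_squared[OF hq, of z]] unfolding q_def dq by simp
    from levi_cmult[OF levi_ln[OF this qz], of 2]
    have lq: "levi (\<lambda>z. 2 * ln (q z)) z (of_real 2 * (- cnj (z - z0) / of_real (q z))) (- 2 * R\<^sup>2 / (q z)\<^sup>2)"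
    proof (rule levi_cong[OF _ refl])
      have "(cmod (- cnj (z - z0)))\<^sup>2 = R\<^sup>2 - q z"
        by (simp add: q_def del: complex_cnj_diff)
      then show "2 * (- 1 / q z - (cmod (- cnj (z - z0)))\<^sup>2 / (q z)\<^sup>2) = - 2 * R\<^sup>2 / (q z)\<^sup>2"
        using qz by (simp only:) (simp add: field_simps power2_eq_square)
    qed
    have lW: "levi (\<lambda>z. ln ((cmod (W z))\<^sup>2)) z (deriv W z * cnj (W z) / of_real ((cmod (W z))\<^sup>2)) 0"
      using levi_ln[OF levi_norm_squared[OF W, of z]] Wz
      by (simp add: norm_mult power_mult_distrib field_simps power2_eq_square)
    \<comment> \<open>The Levi form of \<open>ln (H q^2)\<close> is nonpositive at the maximum point
      \<open>z\<close>.\<close>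
    have "l - 2 * R\<^sup>2 / (q z)\<^sup>2 \<le> 0"
    proof -
      have "0 + l + - 2 * R\<^sup>2 / (q z)\<^sup>2 \<le> 0"
      proof (rule levi_local_max[OF levi_add[OF levi_add[OF lW gl(1)] lq]])
        have "isCont W z" using contW by (simp add: continuous_on_eq_continuous_at)
        then have "\<forall>\<^sub>F w in nhds z. W w \<in> - {0}"
          using Wz by (intro topological_tendstoD[of W "W z" "nhds z" "-{0}"])
            (auto simp: isCont_def tendsto_at_iff_tendsto_nhds)
        moreover have "\<forall>\<^sub>F w in nhds z. w \<in> ball z0 R"
          using zin by (intro eventually_nhds_in_open) auto
        ultimately show "\<forall>\<^sub>F w in nhds z. ln ((cmod (W w))\<^sup>2) + \<rho> w + 2 * ln (q w)
            \<le> ln ((cmod (W z))\<^sup>2) + \<rho> z + 2 * ln (q z)"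
        proof eventually_elim
          case (elim w)
          have *: "ln ((cmod (W x))\<^sup>2) + \<rho> x + 2 * ln (q x) = ln (H x * (q x)\<^sup>2)"
            if "W x \<noteq> 0" "q x > 0" for x
            using that by (simp add: H_def ln_mult ln_realpow)
          have qw: "q w > 0" using elim(2) R
            by (auto simp: q_def dist_norm norm_minus_commute intro!: power_strict_mono)
          have "H w > 0" using elim(1) by (auto simp: H_def)
          show ?case
            unfolding *[OF Wz qz] using elim qw z(2)[of w] pos \<open>H w > 0\<close>
            by (subst *) (auto intro!: ln_mono)
        qed
      qed
      then show ?thesis by simp
    qed
    with gl(2) have "c * H z \<le> 2 * R\<^sup>2 / (q z)\<^sup>2" by simp
    then have "c * (H z * (q z)\<^sup>2) \<le> 2 * R\<^sup>2" using qz by (simp add: field_simps)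
    with at0 \<open>c > 0\<close> have "c * (H z0 * R ^ 4) \<le> 2 * R\<^sup>2"
      by (meson mult_left_mono less_imp_le order_trans)
    then have "(c * H z0 * R\<^sup>2) * R\<^sup>2 \<le> 2 * R\<^sup>2" by (simp add: power2_eq_square power4_eq_xxxx mult_ac)
    then show ?thesis using R by simp
  qed
  \<comment> \<open>This radius turns the bound into 3 \<le> 2.\<close>
  define R where "R = sqrt (3 / (c * H z0))"
  have "R > 0" "R\<^sup>2 = 3 / (c * H z0)" using H0 \<open>c > 0\<close> by (auto simp: R_def)
  with bound[of R] H0 \<open>c > 0\<close> show False by simp
qed

section \<open>Vanishing of the Wronskian\<close>

text \<open>The lower bound for the Levi form of \<open>b l + e\<^sup>-\<^sup>b\<^sup>l / 2 + B u\<^sup>2 e\<^sup>b\<^sup>l\<close> with \<open>l = ln T\<close>: here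
  \<open>S = e\<^sup>b\<^sup>l\<close>, \<open>x = |\<partial>l|\<^sup>2\<close>, \<open>g = |\<partial>u|\<^sup>2\<close>, \<open>r\<close> is the real part of \<open>\<partial>u\<close> times the conjugate of
  \<open>\<partial>l\<close>, \<open>y\<close> and \<open>D\<close> are the Levi forms of \<open>l\<close> and \<open>u\<close>, and \<open>w\<close> is the squared Wronskian. The second summand
  produces the positive term \<open>b\<^sup>2 E / (2 T S)\<close>, which absorbs the errors of the third.\<close>

lemma curvature_estimate:
  fixes b B K T S E D u w g x y r :: real
  assumes "0 < b" "b \<le> 1" "1 \<le> K" "1 \<le> T" "1 \<le> S" "0 \<le> E" "0 \<le> w" "0 \<le> g" "0 \<le> x" "0 \<le> y"
    and u: "\<bar>u\<bar> * S\<^sup>2 \<le> K"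
    and D: "\<bar>D\<bar> \<le> E" "(T - 1) * D = 2 * T * r - u * E"
    and g: "g = w + u * D" and r: "r\<^sup>2 \<le> g * x" and xy: "x + y = E / T"
    and B: "B = b\<^sup>2 / (62 * K\<^sup>2)"
  shows "B * S * w \<le> b * y + (b\<^sup>2 * x - b * y) / (2 * S) +
    B * (S * (2 * g + 2 * u * D + 4 * u * b * r + u\<^sup>2 * (b\<^sup>2 * x + b * y)))"
proof -
  define e where "e = E / T"
  have e: "0 \<le> e" "x \<le> e" using xy assms by (auto simp: e_def)
  have S: "S > 0" "T > 0" using assms by auto
  have "b\<^sup>2 \<le> b" using assms by (simp add: power2_eq_square mult_left_le)
  have u1: "S * \<bar>u\<bar> \<le> K / S"
    using u S by (simp add: field_simps power2_eq_square)
  have "u\<^sup>2 * S\<^sup>2 \<le> K\<^sup>2 / S\<^sup>2"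
    using power_mono[OF u1, of 2] S by (simp add: power_mult_distrib power_divide mult.commute)
  also have "\<dots> \<le> K\<^sup>2 / 1" using assms by (intro divide_left_mono) auto
  finally have u2: "S * u\<^sup>2 \<le> K\<^sup>2 / S" using S by (simp add: field_simps power2_eq_square)
  have "K \<le> K\<^sup>2" using assms by (simp add: power2_eq_square)
  then have u1': "S * \<bar>u\<bar> \<le> K\<^sup>2 / S" using u1 S by (simp add: field_simps)
  \<comment> \<open>Both \<open>S |u|\<close> and \<open>S u^2\<close> are at most
    \<open>K^2 / S\<close>, and 31 = 3 + 28.\<close>
  have small: "S * (3 * \<bar>u\<bar> + 28 * u\<^sup>2) \<le> 31 * (K\<^sup>2 / S)"
  proof -
    have "S * (3 * \<bar>u\<bar> + 28 * u\<^sup>2) = 3 * (S * \<bar>u\<bar>) + 28 * (S * u\<^sup>2)" by (simp add: algebra_simps)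
    then show ?thesis using u1' u2 by linarith
  qed
  \<comment> \<open>As \<open>S >= 1\<close>, at most half of \<open>b y\<close> is lost; the rest
    dominates \<open>b^2 y / (2 S)\<close>, which joins the \<open>x\<close> term through
    \<open>x + y = e\<close>.\<close>
  have first: "b\<^sup>2 * e / (2 * S) \<le> b * y + (b\<^sup>2 * x - b * y) / (2 * S)"
  proof -
    have "b * y / S \<le> b * y / 1" using assms by (intro divide_left_mono) auto
    moreover have "b\<^sup>2 * y / (2 * S) \<le> b * y / (2 * S)"
      using \<open>b\<^sup>2 \<le> b\<close> assms S by (intro divide_right_mono mult_right_mono) auto
    moreover have "b\<^sup>2 * e / (2 * S) = b\<^sup>2 * x / (2 * S) + b\<^sup>2 * y / (2 * S)"
      using xy by (simp add: e_def add_divide_distrib[symmetric] distrib_left[symmetric])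
    ultimately show ?thesis by (simp add: diff_divide_distrib)
  qed
  \<comment> \<open>The equation for \<open>D\<close> is multiplied by \<open>u\<close> and divided
    by \<open>T\<close>; replacing \<open>T - 1\<close> by \<open>T\<close> costs only
    \<open>|u D| <= |u| E\<close>.\<close>
  have uD: "\<bar>u * D\<bar> \<le> \<bar>u\<bar> * e + 2 * \<bar>u * r\<bar> + u\<^sup>2 * e"
  proof -
    have "T * (u * D) = u * D + 2 * T * (u * r) - u\<^sup>2 * E"
      using arg_cong[OF D(2), of "\<lambda>z. u * z"] by (simp add: algebra_simps power2_eq_square)
    moreover have "\<bar>u * D\<bar> \<le> \<bar>u\<bar> * E" using D(1) by (simp add: abs_mult mult_left_mono)
    moreover have "\<bar>u\<^sup>2 * E\<bar> = u\<^sup>2 * E" "\<bar>2 * T * (u * r)\<bar> = T * (2 * \<bar>u * r\<bar>)"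
      using assms by (auto simp: abs_mult)
    ultimately have "\<bar>T * (u * D)\<bar> \<le> \<bar>u\<bar> * E + T * (2 * \<bar>u * r\<bar>) + u\<^sup>2 * E" by linarith
    moreover have "\<bar>T * (u * D)\<bar> = T * \<bar>u * D\<bar>" using S by (simp add: abs_mult)
    moreover have "E = T * e" using S by (simp add: e_def)
    ultimately have "T * \<bar>u * D\<bar> \<le> T * (\<bar>u\<bar> * e + 2 * \<bar>u * r\<bar> + u\<^sup>2 * e)"
      by (simp add: algebra_simps)
    then show ?thesis using S by simp
  qed
  \<comment> \<open>AM-GM for \<open>g\<close> and \<open>25 u^2 e\<close>, using
    \<open>r^2 <= g x <= g e\<close>. The factor is 10 = 6 + 4: six from three copies of the bound
    on \<open>u D\<close>, four from the mixed term.\<close>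
  have ur: "10 * \<bar>u * r\<bar> \<le> g + 25 * u\<^sup>2 * e"
  proof -
    have "(10 * \<bar>u * r\<bar>)\<^sup>2 = 100 * u\<^sup>2 * r\<^sup>2" by (simp add: power_mult_distrib)
    also have "\<dots> \<le> 100 * u\<^sup>2 * (g * e)"
      using r e assms by (intro mult_left_mono order_trans[OF r]) auto
    also have "\<dots> \<le> (g + 25 * u\<^sup>2 * e)\<^sup>2"
      using sum_squares_ge_zero[of "g - 25 * u\<^sup>2 * e" 0] by (simp add: power2_eq_square algebra_simps)
    finally show ?thesis by (rule power2_le_imp_le) (use assms e in auto)
  qed
  \<comment> \<open>By \<open>g = w + u D\<close> the first two terms are
    \<open>w + g + 3 u D\<close>; the spare \<open>g\<close> is consumed by the AM-GM bound, and 28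
    = 3 + 25.\<close>
  have "w - (3 * \<bar>u\<bar> + 28 * u\<^sup>2) * e \<le> 2 * g + 2 * u * D + 4 * u * b * r"
  proof -
    have "\<bar>4 * u * b * r\<bar> = b * (4 * \<bar>u * r\<bar>)" using assms by (simp add: abs_mult)
    also have "\<dots> \<le> 4 * \<bar>u * r\<bar>" using assms by (simp add: mult_left_le_one_le)
    finally show ?thesis using uD ur g by (simp add: algebra_simps)
  qed
  moreover have "0 \<le> u\<^sup>2 * (b\<^sup>2 * x + b * y)" using assms by simp
  ultimately have "S * (w - (3 * \<bar>u\<bar> + 28 * u\<^sup>2) * e) \<le>
      S * (2 * g + 2 * u * D + 4 * u * b * r + u\<^sup>2 * (b\<^sup>2 * x + b * y))"
    using S by (intro mult_left_mono) auto
  moreover have "S * (3 * \<bar>u\<bar> + 28 * u\<^sup>2) * e \<le> 31 * (K\<^sup>2 / S) * e"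
    using small e by (intro mult_right_mono) auto
  ultimately have "S * w - 31 * (K\<^sup>2 / S) * e \<le>
      S * (2 * g + 2 * u * D + 4 * u * b * r + u\<^sup>2 * (b\<^sup>2 * x + b * y))" (is "_ \<le> ?R")
    by (simp add: algebra_simps)
  then have "B * (S * w - 31 * (K\<^sup>2 / S) * e) \<le> B * ?R"
    by (intro mult_left_mono) (auto simp: B)
  \<comment> \<open>The 62 in \<open>B\<close> is chosen so that the error equals the gain in
    \<open>first\<close>.\<close>
  moreover have "B * (31 * (K\<^sup>2 / S) * e) = b\<^sup>2 * e / (2 * S)"
    using assms S by (simp add: B field_simps)
  ultimately have "B * S * w \<le> b\<^sup>2 * e / (2 * S) + B * ?R"
    by (simp add: algebra_simps)
  with first show ?thesis by linarith
qed

text \<open>When \<open>p'\<close>, \<open>q'\<close> are the derivatives of holomorphic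
  \<open>p\<close>, \<open>q\<close>, the numbers \<open>\<tau>\<close>, \<open>\<gamma>\<close> are
  the Wirtinger derivatives of \<open>N\<close>, \<open>u\<close>, and \<open>E\<close>,
  \<open>D\<close> are their Levi forms. The first identity is Lagrange's and the second its
  indefinite analogue; in the third, \<open>N D + u E\<close> is twice
  \<open>|p p'|^2 - |q q'|^2\<close>.\<close>

lemma cross_identities:
  fixes p q p' q' :: complex
  defines "\<tau> \<equiv> p' * cnj p + q' * cnj q" and "\<gamma> \<equiv> p' * cnj p - q' * cnj q"
    and "N \<equiv> (cmod p)\<^sup>2 + (cmod q)\<^sup>2" and "u \<equiv> (cmod p)\<^sup>2 - (cmod q)\<^sup>2"
    and "E \<equiv> (cmod p')\<^sup>2 + (cmod q')\<^sup>2" and "D \<equiv> (cmod p')\<^sup>2 - (cmod q')\<^sup>2"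
    and "w \<equiv> (cmod (p * q' - p' * q))\<^sup>2"
  shows "(cmod \<tau>)\<^sup>2 = N * E - w" "(cmod \<gamma>)\<^sup>2 = w + u * D" "N * D = 2 * Re (\<gamma> * cnj \<tau>) - u * E"
  by (simp_all only: assms cmod_power2) (simp_all add: algebra_simps power2_eq_square)

text \<open>The weight \<open>\<rho>\<close> is built so that its Levi form dominates a multiple of
  \<open>|W|^2 e^\<rho>\<close>, which is the hypothesis of the Ahlfors argument for the Wronskian
  \<open>W\<close>.\<close>

lemma wronskian_vanishes:
  fixes f g :: "complex \<Rightarrow> complex" and b K :: real
  assumes f: "f holomorphic_on UNIV" and g: "g holomorphic_on UNIV"
    and b: "0 < b" "b \<le> 1" and K: "1 \<le> K"
    and close: "\<And>z. \<bar>(cmod (f z))\<^sup>2 - (cmod (g z))\<^sup>2\<bar> *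
      (1 + (cmod (f z))\<^sup>2 + (cmod (g z))\<^sup>2) powr (2 * b) \<le> K"
  shows "f z * deriv g z - deriv f z * g z = 0"
proof -
  define T where "T z = 1 + (cmod (f z))\<^sup>2 + (cmod (g z))\<^sup>2" for z
  define u where "u z = (cmod (f z))\<^sup>2 - (cmod (g z))\<^sup>2" for z
  define l where "l z = ln (T z)" for z
  define B where "B = b\<^sup>2 / (62 * K\<^sup>2)"
  define \<rho> where "\<rho> z = b * l z + 1/2 * exp (- b * l z) + B * (u z * u z * exp (b * l z))" for z
  define W where "W z = f z * deriv g z - deriv f z * g z" for z
  have T1: "T z \<ge> 1" for z by (simp add: T_def)
  then have Tpos: "T z > 0" for z by (smt (verit))
  have B0: "B > 0" using b K by (simp add: B_def)
  have S1: "1 \<le> exp (b * l z)" for z using T1[of z] b by (simp add: l_def)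
  \<comment> \<open>With \<open>S = exp (b * l z)\<close>, the factor \<open>T powr (2 * b)\<close>
    of the hypothesis is \<open>S\<^sup>2\<close>.\<close>
  have uS: "\<bar>u z\<bar> * (exp (b * l z))\<^sup>2 \<le> K" for z
    using close[of z] Tpos[of z]
    by (simp add: u_def[symmetric] T_def[symmetric] powr_def l_def exp_double[symmetric] mult.assoc)
  have "W z = 0"
  \<comment> \<open>The last two summands of \<open>\<rho>\<close> are at most 1/2 each, so
    \<open>e^\<rho>\<close> is at most \<open>exp 1\<close> times \<open>S\<close>; this explains
    the denominator of \<open>c\<close>.\<close>
  proof (rule Ahlfors_vanishing[where W = W and \<rho> = \<rho> and c = "B / exp 1"])
    show "W holomorphic_on UNIV" unfolding W_def
      by (intro holomorphic_intros f g) auto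
    have cf: "continuous_on UNIV f" "continuous_on UNIV g"
      using f g holomorphic_on_imp_continuous_on by blast+
    have "continuous_on UNIV T" unfolding T_def by (intro continuous_intros cf)
    moreover have "\<forall>z\<in>UNIV. T z \<noteq> 0" using Tpos less_irrefl by metis
    ultimately have "continuous_on UNIV l" unfolding l_def by (rule continuous_on_ln)
    then show "continuous_on UNIV \<rho>"
      unfolding \<rho>_def u_def by (intro continuous_intros cf)
    show "0 < B / exp 1" using B0 by simp
  next
    fix z
    define \<tau> where "\<tau> = deriv f z * cnj (f z) + deriv g z * cnj (g z)"
    define \<gamma> where "\<gamma> = deriv f z * cnj (f z) - deriv g z * cnj (g z)"
    define E where "E = (cmod (deriv f z))\<^sup>2 + (cmod (deriv g z))\<^sup>2"
    define D where "D = (cmod (deriv f z))\<^sup>2 - (cmod (deriv g z))\<^sup>2"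
    define S where "S = exp (b * l z)"
    define w where "w = (cmod (W z))\<^sup>2"
    define x where "x = (cmod \<tau>)\<^sup>2 / (T z)\<^sup>2"
    \<comment> \<open>This is the Levi form \<open>E / T - |\<tau>|^2 / T^2\<close> of
      \<open>l\<close>, rewritten by Lagrange's identity so that it is visibly nonnegative.\<close>
    define y where "y = (E + w) / (T z)\<^sup>2"
    define r where "r = Re (\<gamma> * cnj \<tau>) / T z"
    note id = cross_identities[where p = "f z" and q = "g z" and p' = "deriv f z" and q' = "deriv g z"]
    have id1: "(cmod \<tau>)\<^sup>2 = (T z - 1) * E - w"
      using id(1) by (simp add: \<tau>_def T_def E_def w_def W_def)
    have id2: "(cmod \<gamma>)\<^sup>2 = w + u z * D"
      using id(2) by (simp add: \<gamma>_def u_def D_def w_def W_def)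
    have id3: "(T z - 1) * D = 2 * T z * r - u z * E"
    proof -
      have "T z * r = Re (\<gamma> * cnj \<tau>)" using Tpos[of z] unfolding r_def by simp
      moreover have "T z - 1 = (cmod (f z))\<^sup>2 + (cmod (g z))\<^sup>2" by (simp add: T_def)
      ultimately show ?thesis
        using id(3)[folded \<gamma>_def \<tau>_def u_def D_def E_def] by (simp only: mult.assoc)
    qed
    have lT: "levi T z \<tau> E"
      unfolding T_def \<tau>_def E_def
      using levi_add[OF levi_add[OF levi_const[of 1] levi_norm_squared[OF f]] levi_norm_squared[OF g]]
      by simp
    have lu: "levi u z \<gamma> D"
      unfolding u_def \<gamma>_def D_def by (intro levi_diff levi_norm_squared f g)
    have ll: "levi l z (\<tau> / of_real (T z)) y"
    proof -
      have "E / T z - (cmod \<tau>)\<^sup>2 / (T z)\<^sup>2 = y"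
        using Tpos[of z] unfolding id1 y_def by (simp add: field_simps power2_eq_square)
      with levi_ln[OF lT Tpos] show ?thesis unfolding l_def by simp
    qed
    have nx: "(cmod (\<tau> / of_real (T z)))\<^sup>2 = x"
      by (simp add: x_def norm_divide power_divide)
    define t where "t = \<tau> / of_real (T z)"
    have rt: "Re (\<gamma> * cnj t) = r" using Tpos[of z] by (simp add: t_def r_def Re_divide_of_real)
    have nx': "(cmod t)\<^sup>2 = x" using nx by (simp add: t_def)
    \<comment> \<open>Stated for general \<open>k\<close>: \<open>- b\<close> gives the second
      summand of \<open>\<rho>\<close>, \<open>b\<close> the exponential in the third.\<close>
    have le: "levi (\<lambda>z. exp (k * l z)) z (of_real (exp (k * l z)) * (of_real k * t))
        (exp (k * l z) * (k\<^sup>2 * x + k * y))" for k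
      using levi_exp[OF levi_cmult[OF ll[folded t_def], of k]]
      by (simp add: norm_mult power_mult_distrib nx')
    let ?L = "b * y + (b\<^sup>2 * x - b * y) / (2 * S) + B * (S * (2 * (cmod \<gamma>)\<^sup>2 + 2 * u z * D +
        4 * u z * b * r + (u z)\<^sup>2 * (b\<^sup>2 * x + b * y)))"
    have "\<exists>g'. levi \<rho> z g' ?L"
      unfolding \<rho>_def
    proof (rule exI, rule levi_cong[OF levi_add[OF levi_add[OF levi_cmult[OF ll[folded t_def], of b]
            levi_cmult[OF le[of "-b"], of "1/2"]]
            levi_cmult[OF levi_mult[OF levi_mult[OF lu lu] le[of b]], of B]] refl])
      have c: "2 * Re ((\<gamma> * of_real (u z) + of_real (u z) * \<gamma>) * cnj (of_real S * (of_real b * t)))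
          = 4 * u z * b * S * r"
        unfolding rt[symmetric] by (simp add: algebra_simps)
      have c': "2 * Re (\<gamma> * cnj \<gamma>) = 2 * (cmod \<gamma>)\<^sup>2"
        unfolding cmod_power2 by (simp add: power2_eq_square)
      have s: "exp (- b * l z) = 1 / S" by (simp add: S_def exp_minus field_simps)
      show "b * y + 1/2 * (exp (- b * l z) * ((- b)\<^sup>2 * x + (- b) * y)) +
          B * ((D * u z + 2 * Re (\<gamma> * cnj \<gamma>) + u z * D) * exp (b * l z) +
          2 * Re ((\<gamma> * of_real (u z) + of_real (u z) * \<gamma>) *
            cnj (of_real (exp (b * l z)) * (of_real b * t))) +
          u z * u z * (exp (b * l z) * (b\<^sup>2 * x + b * y))) = ?L"
        unfolding s unfolding S_def[symmetric] c c'
        by (simp add: field_simps power2_eq_square)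
    qed
    moreover have "B * S * w \<le> ?L"
    proof (rule curvature_estimate[where K = K and T = "T z" and E = E])
      show "\<bar>D\<bar> \<le> E" unfolding D_def E_def by (simp add: abs_le_iff)
      show "0 \<le> (cmod \<gamma>)\<^sup>2" by simp
      have "\<bar>r\<bar> \<le> cmod \<gamma> * cmod t"
        unfolding rt[symmetric] by (metis abs_Re_le_cmod complex_mod_cnj norm_mult)
      from power_mono[OF this, of 2] show "r\<^sup>2 \<le> (cmod \<gamma>)\<^sup>2 * x"
        by (simp add: power_mult_distrib nx')
      show "x + y = E / T z"
        using Tpos[of z] unfolding x_def y_def id1 by (simp add: field_simps power2_eq_square)
    qed (use b K T1 S1 uS id2 id3 in \<open>auto simp: S_def B_def E_def w_def x_def y_def\<close>)
    moreover have "B / exp 1 * ((cmod (W z))\<^sup>2 * exp (\<rho> z)) \<le> B * S * w"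
    proof -
      have S: "S \<ge> 1" using S1 by (simp add: S_def)
      \<comment> \<open>The bound on \<open>|u| S^2\<close> is squared, and
        \<open>S <= S^4\<close>.\<close>
      have "u z * u z * S \<le> K\<^sup>2"
      proof -
        have "u z * u z * S = \<bar>u z\<bar>\<^sup>2 * S" by (simp add: power2_eq_square)
        also have "\<dots> \<le> \<bar>u z\<bar>\<^sup>2 * (S\<^sup>2)\<^sup>2"
          using S by (intro mult_left_mono) (auto simp: power_mult[symmetric] intro: self_le_power)
        also have "\<dots> = (\<bar>u z\<bar> * S\<^sup>2)\<^sup>2" by (simp add: power_mult_distrib)
        also have "\<dots> \<le> K\<^sup>2" using uS[of z] by (intro power_mono) (auto simp: S_def)
        finally show ?thesis .
      qed
      then have "B * (u z * u z * S) \<le> B * K\<^sup>2" using B0 by (intro mult_left_mono) auto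
      also have "\<dots> = b\<^sup>2 / 62" using K by (simp add: B_def)
      also have "\<dots> \<le> 1 / 2" using power_le_one[of b 2] b by simp
      finally have "B * (u z * u z * S) \<le> 1 / 2" .
      moreover have "exp (- b * l z) \<le> 1"
        using T1[of z] b by (simp add: l_def)
      ultimately have "\<rho> z \<le> b * l z + 1" unfolding \<rho>_def S_def by linarith
      then have "exp (\<rho> z) \<le> exp 1 * S" by (simp add: S_def mult_exp_exp add.commute)
      then have "B / exp 1 * ((cmod (W z))\<^sup>2 * exp (\<rho> z)) \<le> B / exp 1 * ((cmod (W z))\<^sup>2 * (exp 1 * S))"
        using B0 by (intro mult_left_mono) auto
      then show ?thesis by (simp add: w_def mult_ac)
    qed
    ultimately show "\<exists>g' l'. levi \<rho> z g' l' \<and> B / exp 1 * ((cmod (W z))\<^sup>2 * exp (\<rho> z)) \<le> l'"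
      by (meson order_trans)
  qed
  then show ?thesis by (simp add: W_def)
qed

section \<open>Proportional entire functions and bijective entire functions\<close>

text \<open>On a disc where \<open>g\<close> has no zero the quotient has derivative 0; the identity
  theorem carries the resulting relation to the whole plane, across the zeros of
  \<open>g\<close>.\<close>

lemma wronskian_zero_imp_proportional:
  assumes f: "f holomorphic_on UNIV" and g: "g holomorphic_on UNIV"
    and W: "\<And>z. f z * deriv g z - deriv f z * g z = 0" and g0: "g z0 \<noteq> 0"
  obtains c where "\<And>z. f z = c * g z"
proof -
  have "isCont g z0"
    using holomorphic_on_imp_continuous_on[OF g] by (simp add: continuous_on_eq_continuous_at)
  then obtain e where e: "e > 0" "\<And>z. dist z0 z < e \<Longrightarrow> g z \<noteq> 0"
    using continuous_at_avoid[of z0 g 0] g0 by auto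
  have der: "(f has_field_derivative deriv f z) (at z)" "(g has_field_derivative deriv g z) (at z)" for z
    using f g holomorphic_derivI by blast+
  have "\<exists>c. \<forall>z\<in>ball z0 e. f z / g z = c"
  proof (rule has_field_derivative_zero_constant[OF convex_ball])
    fix z assume "z \<in> ball z0 e"
    then have "((\<lambda>z. f z / g z) has_field_derivative
        (deriv f z * g z - f z * deriv g z) / (g z * g z)) (at z within ball z0 e)"
      using e(2) by (intro has_field_derivative_at_within[OF DERIV_divide[OF der]]) auto
    then show "((\<lambda>z. f z / g z) has_field_derivative 0) (at z within ball z0 e)"
      using W[of z] by (simp add: algebra_simps)
  qed
  then obtain c where c: "\<And>z. z \<in> ball z0 e \<Longrightarrow> f z / g z = c" by blast
  have "f z - c * g z = 0" for z
  proof (rule analytic_continuation[where f = "\<lambda>z. f z - c * g z" and S = UNIV and U = "ball z0 e" and \<xi> = z0])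
    show "(\<lambda>z. f z - c * g z) holomorphic_on UNIV" by (intro holomorphic_intros f g)
    show "z0 islimpt ball z0 e" using e(1) by (simp add: islimpt_ball)
    show "f z - c * g z = 0" if "z \<in> ball z0 e" for z
      using c[OF that] e(2)[of z] that by (auto simp: field_simps)
  qed auto
  then show ?thesis by (intro that[of c]) simp
qed

text \<open>Continuity of the inverse makes \<open>g\<close> proper, so \<open>g\<close> has a pole
  at infinity and is a polynomial. By injectivity its derivative has no zero, hence is constant by
  the fundamental theorem of algebra.\<close>

lemma bijective_entire_is_affine:
  assumes g: "g holomorphic_on UNIV" and k: "continuous_on UNIV k"
    and kg: "\<And>z. k (g z) = z" and gk: "\<And>z. g (k z) = z"
  obtains \<alpha> \<beta> :: complex where "\<And>z. g z = \<alpha> * z + \<beta>"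
proof -
  have inj: "inj g" by (metis injI kg)
  have "((inverse \<circ> g) \<longlongrightarrow> 0) at_infinity"
  proof -
    have "filterlim g at_infinity at_infinity"
      unfolding filterlim_at_infinity[OF order.refl, of g]
    proof (intro allI impI)
      fix r :: real
      have "bounded (k ` cball 0 r)"
        by (intro compact_imp_bounded compact_continuous_image continuous_on_subset[OF k]) auto
      then obtain B where B: "\<And>w. w \<in> cball 0 r \<Longrightarrow> norm (k w) \<le> B"
        unfolding bounded_iff by blast
      show "\<forall>\<^sub>F x in at_infinity. r \<le> norm (g x)"
        unfolding eventually_at_infinity
      proof (intro exI[of _ "B + 1"] allI impI)
        fix x :: complex assume "B + 1 \<le> norm x"
        then show "r \<le> norm (g x)" using B[of "g x"] kg[of x] by fastforce
      qed
    qed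
    then show ?thesis
      unfolding o_def by (rule tendsto_inverse_0[THEN filterlim_compose])
  qed
  then obtain a n where a: "\<And>z. g z = (\<Sum>i\<le>n. a i * z ^ i)"
    using pole_at_infinity[OF g] by blast
  define p where "p = (\<Sum>i\<le>n. monom (a i) i)"
  have p: "g = poly p" by (rule ext) (simp add: a p_def poly_sum poly_monom)
  have "deriv g z \<noteq> 0" for z
    using holomorphic_injective_imp_regular[OF g open_UNIV inj, of z] by simp
  moreover have "deriv g z = poly (pderiv p) z" for z
    by (simp add: p DERIV_imp_deriv[OF poly_DERIV])
  ultimately have "constant (poly (pderiv p))"
    using Fundamental_Theorem_Algebra.fundamental_theorem_of_algebra[of "pderiv p"] by auto
  then have "degree (pderiv p) = 0" by (simp add: constant_degree)
  then have "degree p \<le> 1" by (simp add: degree_pderiv)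
  then have "g z = coeff p 1 * z + coeff p 0" for z
  proof -
    have "poly p z = (\<Sum>i\<le>1. coeff p i * z ^ i)"
      unfolding poly_altdef using \<open>degree p \<le> 1\<close>
      by (intro sum.mono_neutral_left) (auto simp: coeff_eq_0)
    then show ?thesis by (simp add: p)
  qed
  then show ?thesis by (rule that)
qed

section \<open>The domain and its torus lines\<close>

lemma open_Dom: "open (Dom a m)"
proof -
  have "Dom a m = (\<Inter>k\<in>{k. k \<noteq> m}. {z. \<bar>(cmod (z $ k))\<^sup>2 - (cmod (z $ m))\<^sup>2\<bar> <
      ((cmod (z $ m))\<^sup>2 + 1) powr (- a)})"
    by (auto simp: Dom_def)
  moreover have "(cmod w)\<^sup>2 + 1 \<noteq> 0" for w
    by (smt (verit) zero_le_power2)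
  ultimately show ?thesis
    by (auto intro!: open_INT open_Collect_less continuous_intros)
qed

text \<open>Scaling by \<open>t\<close> multiplies the left side of the defining inequality by
  \<open>|t|^2\<close>, while the right side, decreasing in the modulus of the distinguished
  coordinate, does not shrink.\<close>

lemma balanced_Dom:
  assumes "a > 0" "z \<in> Dom a m" "cmod t \<le> 1"
  shows "t *s z \<in> Dom a m"
  unfolding Dom_def
proof (intro CollectI allI impI)
  fix k assume "k \<noteq> m"
  then have z: "\<bar>(cmod (z $ k))\<^sup>2 - (cmod (z $ m))\<^sup>2\<bar> < ((cmod (z $ m))\<^sup>2 + 1) powr (- a)"
    using assms by (auto simp: Dom_def)
  have t: "(cmod t)\<^sup>2 \<le> 1" using assms by (simp add: power_le_one)
  have "\<bar>(cmod ((t *s z) $ k))\<^sup>2 - (cmod ((t *s z) $ m))\<^sup>2\<bar> =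
      (cmod t)\<^sup>2 * \<bar>(cmod (z $ k))\<^sup>2 - (cmod (z $ m))\<^sup>2\<bar>"
    by (simp add: norm_mult power_mult_distrib abs_mult flip: right_diff_distrib)
  also have "\<dots> \<le> \<bar>(cmod (z $ k))\<^sup>2 - (cmod (z $ m))\<^sup>2\<bar>"
    using t by (simp add: mult_left_le_one_le)
  also note z
  also have "((cmod (z $ m))\<^sup>2 + 1) powr (- a) \<le> ((cmod ((t *s z) $ m))\<^sup>2 + 1) powr (- a)"
    using assms(1) t
    by (intro powr_mono2') (auto simp: norm_mult power_mult_distrib mult_left_le_one_le add_nonneg_pos)
  finally show "\<bar>(cmod ((t *s z) $ k))\<^sup>2 - (cmod ((t *s z) $ m))\<^sup>2\<bar> <
      ((cmod ((t *s z) $ m))\<^sup>2 + 1) powr (- a)" .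
qed

text \<open>Normalising coordinate \<open>m\<close> to 1 picks one direction per line and makes that
  coordinate the parameter on the line.\<close>

definition torus :: "'n::finite \<Rightarrow> (complex^'n) set" where
  "torus m = {v. v $ m = 1 \<and> (\<forall>k. cmod (v $ k) = 1)}"

lemma torus_line_in_Dom:
  assumes "v \<in> torus m"
  shows "\<zeta> *s v \<in> Dom a m"
proof -
  have "0 < ((cmod \<zeta>)\<^sup>2 + 1) powr (- a)"
    by (smt (verit) powr_gt_zero zero_le_power2)
  then show ?thesis using assms by (simp add: Dom_def torus_def norm_mult)
qed

lemma bounded_linear_vector_scalar_mult_left:
  fixes q :: "complex^'n::finite"
  shows "bounded_linear (\<lambda>t. t *s q)"
  by (intro linear_conv_bounded_linear[THEN iffD1] linearI) (auto simp: vec_eq_iff algebra_simps)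

lemma holo_Cn_line:
  assumes "holo_Cn f S" "p + t *s q \<in> S"
  shows "(\<lambda>t. f (p + t *s q) $ k) field_differentiable (at t)"
proof -
  obtain L where L: "(f has_derivative L) (at (p + t *s q))" "\<And>c v. L (c *s v) = c *s L v"
    using assms by (auto simp: holo_Cn_def)
  have "((\<lambda>t. p + t *s q) has_derivative (\<lambda>t. t *s q)) (at t)"
  proof -
    from has_derivative_add[OF has_derivative_const
        bounded_linear_imp_has_derivative[OF bounded_linear_vector_scalar_mult_left]]
    show ?thesis by simp
  qed
  from has_derivative_compose[OF this L(1)]
  have "((\<lambda>t. f (p + t *s q) $ k) has_derivative (\<lambda>t. L (t *s q) $ k)) (at t)"
    by (rule bounded_linear.has_derivative[OF bounded_linear_vec_nth])
  then have "((\<lambda>t. f (p + t *s q) $ k) has_field_derivative L q $ k) (at t)"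
    by (rule has_derivative_imp_has_field_derivative) (simp add: L(2))
  then show ?thesis by (auto simp: field_differentiable_def)
qed

text \<open>This supplies the closeness hypothesis of the Wronskian lemma with \<open>K = 4\<close>.
  The choice of \<open>b\<close> gives \<open>2 b <= a\<close> for the decay and
  \<open>b <= 1\<close> as required there; since the squared moduli differ by at most 1, the sum is
  at most \<open>2 s\<close>, and \<open>2 powr (2 * b) <= 4\<close>.\<close>

lemma Dom_close:
  assumes "a > 0" "w \<in> Dom a m" "k \<noteq> m" and b: "b = min (a / 2) 1"
  shows "\<bar>(cmod (w $ k))\<^sup>2 - (cmod (w $ m))\<^sup>2\<bar> *
    (1 + (cmod (w $ k))\<^sup>2 + (cmod (w $ m))\<^sup>2) powr (2 * b) \<le> 4"
proof -
  define s where "s = (cmod (w $ m))\<^sup>2 + 1"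
  have s: "s \<ge> 1" by (simp add: s_def)
  have b: "0 < b" "2 * b \<le> a" "2 * b \<le> 2" using assms by auto
  have u: "\<bar>(cmod (w $ k))\<^sup>2 - (cmod (w $ m))\<^sup>2\<bar> < s powr (- a)"
    using assms by (auto simp: Dom_def s_def)
  also have "\<dots> \<le> s powr (- (2 * b))" using s b by (intro powr_mono) auto
  finally have u: "\<bar>(cmod (w $ k))\<^sup>2 - (cmod (w $ m))\<^sup>2\<bar> \<le> s powr (- (2 * b))" by simp
  also have "\<dots> \<le> 1" using s b powr_mono[of "- (2 * b)" 0 s] by simp
  finally have "1 + (cmod (w $ k))\<^sup>2 + (cmod (w $ m))\<^sup>2 \<le> 2 * s" using s by (simp add: s_def)
  then have "(1 + (cmod (w $ k))\<^sup>2 + (cmod (w $ m))\<^sup>2) powr (2 * b) \<le> (2 * s) powr (2 * b)"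
    using b by (intro powr_mono2) auto
  with u have "\<bar>(cmod (w $ k))\<^sup>2 - (cmod (w $ m))\<^sup>2\<bar> *
    (1 + (cmod (w $ k))\<^sup>2 + (cmod (w $ m))\<^sup>2) powr (2 * b) \<le> s powr (- (2 * b)) * (2 * s) powr (2 * b)"
    by (intro mult_mono) auto
  also have "\<dots> = 2 powr (2 * b)" using s by (simp add: powr_mult powr_minus)
  also have "\<dots> \<le> 2 powr 2" using b by (intro powr_mono) auto
  finally show ?thesis by simp
qed

section \<open>Entire curves in the domain\<close>

text \<open>The vanishing Wronskian makes each coordinate a multiple of the distinguished one. As
  the latter is unbounded while the squared moduli stay within distance 1, the factor has modulus
  one.\<close>

lemma entire_curve_in_Dom:
  assumes a: "a > 0" and hol: "\<And>k. (\<lambda>t. F t $ k) holomorphic_on UNIV"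
    and D: "\<And>t. F t \<in> Dom a m" and inj: "inj F"
  obtains c where "c \<in> torus m" "\<And>t. F t = F t $ m *s c"
proof -
  have diff: "\<bar>(cmod (F t $ k))\<^sup>2 - (cmod (F t $ m))\<^sup>2\<bar> \<le> 1" for t k
  proof (cases "k = m")
    case False
    then have "\<bar>(cmod (F t $ k))\<^sup>2 - (cmod (F t $ m))\<^sup>2\<bar> \<le> ((cmod (F t $ m))\<^sup>2 + 1) powr (- a)"
      using D[of t] by (auto simp: Dom_def intro: less_imp_le)
    also have "\<dots> \<le> ((cmod (F t $ m))\<^sup>2 + 1) powr 0" using a by (intro powr_mono) auto
    finally show ?thesis by (smt (verit) powr_zero_eq_one)
  qed simp
  \<comment> \<open>A bound on coordinate \<open>m\<close> bounds all the others, and Liouville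
    would make \<open>F\<close> constant, against injectivity.\<close>
  have unbounded: "\<not> (\<forall>t. (cmod (F t $ m))\<^sup>2 \<le> C)" for C
  proof
    assume C: "\<forall>t. (cmod (F t $ m))\<^sup>2 \<le> C"
    have "F t $ k = F 0 $ k" for t k
    proof -
      have "cmod (F t $ k) \<le> C + 2" for t
      proof -
        have "(cmod (F t $ k))\<^sup>2 \<le> C + 1" using diff[of t k] C[rule_format, of t] by linarith
        moreover have "cmod (F t $ k) \<le> (cmod (F t $ k))\<^sup>2 + 1"
          using sum_squares_ge_zero[of "cmod (F t $ k) - 1" 0]
            norm_ge_zero[of "F t $ k"] by (simp add: power2_eq_square algebra_simps del: norm_ge_zero)
        ultimately show ?thesis by linarith
      qed
      then have "bounded (range (\<lambda>t. F t $ k))" by (auto simp: bounded_iff)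
      from Liouville_theorem[OF hol this] obtain d where "\<And>z. F z $ k = d" by (metis constant_on_def UNIV_I)
      then show ?thesis by simp
    qed
    then have "F 1 = F 0" by (simp add: vec_eq_iff)
    with inj show False by (auto dest: injD)
  qed
  \<comment> \<open>Unboundedness with \<open>C = 0\<close> yields a point where the distinguished
    coordinate is nonzero.\<close>
  from unbounded[of 0] obtain t0 where t0: "F t0 $ m \<noteq> 0" by fastforce
  have "\<exists>c. cmod c = 1 \<and> (k = m \<longrightarrow> c = 1) \<and> (\<forall>t. F t $ k = c * F t $ m)" for k
  proof (cases "k = m")
    case False
    define b where "b = min (a / 2) 1"
    have b: "0 < b" "b \<le> 1" using a by (auto simp: b_def)
    have "F t $ k * deriv (\<lambda>t. F t $ m) t - deriv (\<lambda>t. F t $ k) t * F t $ m = 0" for t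
      by (rule wronskian_vanishes[OF hol hol b, of 4])
        (use Dom_close[OF a D False b_def] in auto)
    then obtain c where c: "\<And>t. F t $ k = c * F t $ m"
      using wronskian_zero_imp_proportional[OF hol[of k] hol[of m], of t0] t0 by metis
    have "cmod c = 1"
    proof (rule ccontr)
      assume "cmod c \<noteq> 1"
      then have d: "\<bar>(cmod c)\<^sup>2 - 1\<bar> > 0" by (smt (verit) norm_ge_zero power2_eq_1_iff)
      have "(cmod (F t $ m))\<^sup>2 \<le> 1 / \<bar>(cmod c)\<^sup>2 - 1\<bar>" for t
      proof -
        have "\<bar>(cmod c)\<^sup>2 - 1\<bar> * (cmod (F t $ m))\<^sup>2 = \<bar>((cmod c)\<^sup>2 - 1) * (cmod (F t $ m))\<^sup>2\<bar>"
          by (simp add: abs_mult)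
        also have "\<dots> \<le> 1"
          using diff[of t k] by (simp add: c norm_mult power_mult_distrib algebra_simps)
        finally show ?thesis using d by (simp add: field_simps)
      qed
      with unbounded show False by blast
    qed
    with c False show ?thesis by auto
  qed (auto intro: exI[of _ 1])
  then obtain c where c: "\<And>k. cmod (c k) = 1" "c m = 1" "\<And>k t. F t $ k = c k * F t $ m" by metis
  show ?thesis
  proof (rule that[of "\<chi> k. c k"])
    show "(\<chi> k. c k) \<in> torus m" using c(1,2) by (simp add: torus_def)
    show "F t = F t $ m *s (\<chi> k. c k)" for t
      unfolding vec_eq_iff using c(3)[of t] by (metis mult.commute vec_lambda_beta vector_smult_component)
  qed
qed

section \<open>Automorphisms on torus lines\<close>

lemma torus_line_holomorphic:
  assumes "holo_Cn f (Dom a m)" "v \<in> torus m"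
  shows "(\<lambda>t. f (t *s v) $ k) holomorphic_on UNIV"
  using holo_Cn_line[OF assms(1), of 0 _ v k] torus_line_in_Dom[OF assms(2), of _ a]
  by (simp add: holomorphic_on_def field_differentiable_at_within)

text \<open>Formulated for injective holomorphic self-maps, so that it applies to an automorphism
  and to its inverse alike.\<close>

lemma injective_image_of_torus_line:
  assumes "a > 0" and f: "holo_Cn f (Dom a m)" "f ` Dom a m \<subseteq> Dom a m" "inj_on f (Dom a m)"
    and v: "v \<in> torus m"
  obtains c where "c \<in> torus m" "\<And>t. f (t *s v) = f (t *s v) $ m *s c"
proof (rule entire_curve_in_Dom[OF assms(1) torus_line_holomorphic[OF f(1) v]])
  show "f (t *s v) \<in> Dom a m" for t using f(2) torus_line_in_Dom[OF v] by blast
  show "inj (\<lambda>t. f (t *s v))"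
  proof (rule injI)
    fix s t assume "f (s *s v) = f (t *s v)"
    then have "s *s v = t *s v" using f(3) torus_line_in_Dom[OF v] by (auto dest: inj_onD)
    then show "s = t" using v by (auto simp: torus_def vec_eq_iff dest: spec[of _ m])
  qed
qed (rule that)

text \<open>The automorphism sends the line of \<open>v\<close> into that of \<open>c\<close>, and
  the inverse sends the line of \<open>c\<close> into that of \<open>d\<close>. Composing gives
  \<open>d = v\<close>, so the parameter maps \<open>G\<close> and \<open>K\<close> are mutually
  inverse entire functions and \<open>G\<close> is affine.\<close>

lemma automorphism_on_torus_line:
  assumes "a > 0" and \<phi>: "\<phi> \<in> Aut (Dom a m)" and v: "v \<in> torus m"
  obtains c \<alpha> \<beta> where "c \<in> torus m" "\<alpha> \<noteq> 0" "\<And>t. \<phi> (t *s v) = (\<alpha> * t + \<beta>) *s c"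
proof -
  obtain g where holo: "holo_Cn \<phi> (Dom a m)" "holo_Cn g (Dom a m)" and bij: "bij_betw \<phi> (Dom a m) (Dom a m)"
    and inv: "\<And>z. z \<in> Dom a m \<Longrightarrow> g (\<phi> z) = z" "\<And>z. z \<in> Dom a m \<Longrightarrow> \<phi> (g z) = z"
    using \<phi> by (auto simp: Aut_def)
  have image: "\<phi> ` Dom a m = Dom a m" using bij by (auto simp: bij_betw_def)
  \<comment> \<open>The inverse identities alone do not place the values of \<open>g\<close> in the
    domain; surjectivity of \<open>\<phi>\<close> does.\<close>
  have gimage: "g ` Dom a m \<subseteq> Dom a m"
  proof
    fix z assume "z \<in> g ` Dom a m"
    then obtain y where y: "y \<in> Dom a m" "z = g y" by blast
    then have "y \<in> \<phi> ` Dom a m" by (simp only: image)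
    then obtain x where "x \<in> Dom a m" "y = \<phi> x" by blast
    then show "z \<in> Dom a m" using inv(1)[of x] y(2) by simp
  qed
  have "inj_on \<phi> (Dom a m)" "inj_on g (Dom a m)"
    using inj_on_inverseI[of "Dom a m" g \<phi>] inj_on_inverseI[of "Dom a m" \<phi> g] inv by auto
  note lines = injective_image_of_torus_line[OF \<open>a > 0\<close> holo(1) equalityD1[OF image] this(1)]
    injective_image_of_torus_line[OF \<open>a > 0\<close> holo(2) gimage this(2)]
  obtain c where c: "c \<in> torus m" "\<And>t. \<phi> (t *s v) = \<phi> (t *s v) $ m *s c"
    using lines(1)[OF v] by blast
  obtain d where d: "d \<in> torus m" "\<And>t. g (t *s c) = g (t *s c) $ m *s d"
    using lines(2)[OF c(1)] by blast
  define G where "G t = \<phi> (t *s v) $ m" for t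
  define K where "K t = g (t *s c) $ m" for t
  have m1: "v $ m = 1" "c $ m = 1" "d $ m = 1" using v c(1) d(1) by (auto simp: torus_def)
  have line: "\<phi> (t *s v) = G t *s c" "g (t *s c) = K t *s d" for t
    using c(2) d(2) by (simp_all only: G_def K_def)
  have KG: "K (G t) *s d = t *s v" for t
    using inv(1)[OF torus_line_in_Dom[OF v], of t] by (simp only: line)
  have KG': "K (G t) = t" for t
    using arg_cong[OF KG[of t], of "\<lambda>w. w $ m"] m1 by simp
  have "d = v" using KG[of 1] KG'[of 1] by simp
  have "G (K t) *s c = t *s c" for t
    using inv(2)[OF torus_line_in_Dom[OF c(1)], of t] by (simp only: line \<open>d = v\<close>)
  from arg_cong[OF this, of "\<lambda>w. w $ m"] have GK: "G (K t) = t" for t using m1 by simp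
  have "G holomorphic_on UNIV" "K holomorphic_on UNIV"
    using torus_line_holomorphic[OF holo(1) v] torus_line_holomorphic[OF holo(2) c(1)]
    by (simp_all add: G_def[abs_def] K_def[abs_def])
  then obtain \<alpha> \<beta> where aff: "\<And>t. G t = \<alpha> * t + \<beta>"
    using bijective_entire_is_affine[OF _ holomorphic_on_imp_continuous_on, of G K] KG' GK by metis
  have "\<alpha> \<noteq> 0"
    using KG'[of 0] KG'[of 1] aff[of 0] aff[of 1] by auto
  then show ?thesis by (rule that[OF c(1), of \<alpha> \<beta>]) (simp add: line aff)
qed

text \<open>If \<open>\<phi> 0 \<noteq> 0\<close>, the image lines all contain \<open>\<phi> 0\<close> and the origin, so they coincide, against
  injectivity.\<close>

lemma automorphism_homogeneous_on_torus:
  assumes "CARD('n) \<ge> 2" "a > 0" and \<phi>: "\<phi> \<in> Aut (Dom a (m::'n::finite))" and v: "v \<in> torus m"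
  shows "\<phi> (t *s v) = t *s \<phi> v"
proof -
  have inj: "inj_on \<phi> (Dom a m)" using \<phi> by (auto simp: Aut_def bij_betw_def)
  define p where "p = \<phi> 0"
  have p0: "p = 0"
  proof (rule ccontr)
    assume "p \<noteq> 0"
    \<comment> \<open>Each image line passes through \<open>p\<close>, a nonzero multiple of its
      direction, so all of them can be parametrised with the common direction
      \<open>p\<close>.\<close>
    have *: "\<exists>\<alpha>. \<alpha> \<noteq> 0 \<and> (\<forall>t. \<phi> (t *s w) = (\<alpha> * t + 1) *s p)" if w: "w \<in> torus m" for w
    proof -
      obtain c \<alpha> \<beta> where c: "\<alpha> \<noteq> 0" "\<And>t. \<phi> (t *s w) = (\<alpha> * t + \<beta>) *s c"
        using automorphism_on_torus_line[OF \<open>a > 0\<close> \<phi> w] by metis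
      have p: "p = \<beta> *s c" using c(2)[of 0] by (simp add: p_def)
      with \<open>p \<noteq> 0\<close> have "\<beta> \<noteq> 0" by auto
      then show ?thesis
        using c by (intro exI[of _ "\<alpha> / \<beta>"]) (auto simp: p distrib_right)
    qed
    obtain j where j: "j \<noteq> m"
    proof (rule ccontr)
      assume "\<not> thesis"
      then have "(UNIV :: 'n set) = {m}" using that by auto
      then have "CARD('n) = card {m}" by (rule arg_cong)
      with assms(1) show False by simp
    qed
    \<comment> \<open>Two directions that differ only in coordinate \<open>j\<close>.\<close>
    define v1 :: "complex^'n" where "v1 = (\<chi> k. 1)"
    define v2 :: "complex^'n" where "v2 = (\<chi> k. if k = j then - 1 else 1)"
    have tor: "v1 \<in> torus m" "v2 \<in> torus m" using j by (auto simp: v1_def v2_def torus_def)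
    obtain \<alpha>1 \<alpha>2 where al: "\<alpha>1 \<noteq> 0" "\<And>t. \<phi> (t *s v1) = (\<alpha>1 * t + 1) *s p"
        "\<alpha>2 \<noteq> 0" "\<And>t. \<phi> (t *s v2) = (\<alpha>2 * t + 1) *s p"
      using *[OF tor(1)] *[OF tor(2)] by metis
    \<comment> \<open>Both values are \<open>(\<alpha>1 * \<alpha>2 + 1) *s p\<close>. Injectivity
      then gives \<open>\<alpha>2 = \<alpha>1\<close> in coordinate \<open>m\<close> and
      \<open>\<alpha>2 = - \<alpha>1\<close> in coordinate \<open>j\<close>.\<close>
    have "\<phi> (\<alpha>2 *s v1) = \<phi> (\<alpha>1 *s v2)"
      by (simp add: al mult.commute)
    then have eq: "\<alpha>2 *s v1 = \<alpha>1 *s v2"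
      by (rule inj_onD[OF inj _ torus_line_in_Dom[OF tor(1)] torus_line_in_Dom[OF tor(2)]])
    from arg_cong[OF eq, of "\<lambda>w. w $ m"] arg_cong[OF eq, of "\<lambda>w. w $ j"] al(1) j show False
      by (simp add: v1_def v2_def)
  qed
  obtain c \<alpha> \<beta> where c: "c \<in> torus m" "\<And>t. \<phi> (t *s v) = (\<alpha> * t + \<beta>) *s c"
    using automorphism_on_torus_line[OF \<open>a > 0\<close> \<phi> v] by metis
  have "\<beta> *s c = 0" using c(2)[of 0] p0 by (simp add: p_def)
  from arg_cong[OF this, of "\<lambda>w. w $ m"] have "\<beta> = 0" using c(1) by (simp add: torus_def)
  then show ?thesis using c(2)[of t] c(2)[of 1] by (simp add: mult.commute)
qed

section \<open>From the torus lines to the whole domain\<close>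

text \<open>One coordinate after the other is moved from the distinguished torus into the disc,
  by the maximum principle.\<close>

lemma vanishing_on_polydisc:
  fixes h :: "complex^'n::finite \<Rightarrow> complex"
  assumes hol: "\<And>p q t. (\<forall>k. cmod ((p + t *s q) $ k) \<le> r) \<Longrightarrow>
      (\<lambda>t. h (p + t *s q)) field_differentiable (at t)"
    and zero: "\<And>z. (\<forall>k. cmod (z $ k) = r) \<Longrightarrow> h z = 0" and z: "\<And>k. cmod (z $ k) \<le> r"
  shows "h z = 0"
proof -
  \<comment> \<open>Induction on the set \<open>I\<close> of coordinates that may have modulus below
    \<open>r\<close>.\<close>
  have "\<forall>z. (\<forall>k. cmod (z $ k) \<le> r) \<and> (\<forall>k. k \<notin> I \<longrightarrow> cmod (z $ k) = r) \<longrightarrow> h z = 0"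
    if "finite I" for I
    using that
  proof induction
    case empty
    then show ?case using zero by auto
  next
    case (insert j I)
    show ?case
    proof (intro allI impI, elim conjE)
      fix z assume z: "\<forall>k. cmod (z $ k) \<le> r" "\<forall>k. k \<notin> insert j I \<longrightarrow> cmod (z $ k) = r"
      \<comment> \<open>The line \<open>p + t *s q\<close> varies coordinate \<open>j\<close> alone
        and passes through \<open>z\<close> at \<open>t = z $ j\<close>.\<close>
      define q :: "complex^'n" where "q = axis j 1"
      define p where "p = z - z $ j *s q"
      have pq: "(p + t *s q) $ k = (if k = j then t else z $ k)" for t k
        by (simp add: p_def q_def axis_def)
      have fd: "(\<lambda>t. h (p + t *s q)) field_differentiable (at t)" if "cmod t \<le> r" for t
        using that z(1) by (intro hol) (auto simp del: vector_add_component simp: pq)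
      have circle: "h (p + t *s q) = 0" if "cmod t = r" for t
        using that z by (intro insert.IH[rule_format] conjI allI impI) (auto simp del: vector_add_component simp: pq)
      have zj: "p + (z $ j) *s q = z" by (simp add: p_def)
      show "h z = 0"
      proof (cases "cmod (z $ j) = r")
        case True
        with circle[OF True] zj show ?thesis by simp
      next
        case False
        with z(1) have less: "cmod (z $ j) < r" by (simp add: less_le)
        then have r: "0 < r" by (meson norm_ge_zero order_le_less_trans)
        have "cmod (h (p + (z $ j) *s q)) \<le> 0"
        proof (rule maximum_modulus_frontier[where S = "ball 0 r" and f = "\<lambda>t. h (p + t *s q)" and \<xi> = "z $ j"])
          show "(\<lambda>t. h (p + t *s q)) holomorphic_on interior (ball 0 r)"
            unfolding holomorphic_on_def
            by (intro ballI field_differentiable_at_within[OF fd]) (simp add: less_imp_le)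
          show "continuous_on (closure (ball 0 r)) (\<lambda>t. h (p + t *s q))"
            using r by (intro continuous_at_imp_continuous_on ballI field_differentiable_imp_continuous_at fd) simp
          show "cmod (h (p + t *s q)) \<le> 0" if "t \<in> frontier (ball 0 r)" for t
            using circle[of t] that r by simp
        qed (use less in simp_all)
        with zj show ?thesis by simp
      qed
    qed
  qed
  from this[of UNIV] z show ?thesis by simp
qed

text \<open>The linear map is the differential at 0. Homogeneity along torus lines makes it agree
  with \<open>\<phi>\<close> there, and the difference is then shown to vanish on a polydisc and on
  the domain.\<close>

lemma automorphism_linear:
  assumes "CARD('n) \<ge> 2" and a: "a > 0" and \<phi>: "\<phi> \<in> Aut (Dom a (m::'n::finite))"
  obtains L where "Vector_Spaces.linear (*s) (*s) L" "\<And>z. z \<in> Dom a m \<Longrightarrow> \<phi> z = L z"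
proof -
  have holo: "holo_Cn \<phi> (Dom a m)" using \<phi> by (auto simp: Aut_def)
  have tor1: "(\<chi> k. 1) \<in> torus m" by (simp add: torus_def)
  have zero_in: "0 \<in> Dom a m" using torus_line_in_Dom[OF tor1, of 0 a] by simp
  then obtain L where L: "(\<phi> has_derivative L) (at 0)" "\<And>c v. L (c *s v) = c *s L v"
    using holo by (auto simp: holo_Cn_def)
  have Ladd: "L (x + y) = L x + L y" for x y
    using has_derivative_bounded_linear[OF L(1)] by (simp add: linear_add bounded_linear.linear)
  have Ltorus: "L v = \<phi> v" if v: "v \<in> torus m" for v
  proof -
    have "((\<lambda>t. \<phi> (t *s v)) has_derivative (\<lambda>t. L (t *s v))) (at 0)"
      by (rule has_derivative_compose[OF bounded_linear_imp_has_derivative[OF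
          bounded_linear_vector_scalar_mult_left]]) (simp add: L(1))
    moreover have "((\<lambda>t. \<phi> (t *s v)) has_derivative (\<lambda>t. t *s \<phi> v)) (at 0)"
      unfolding automorphism_homogeneous_on_torus[OF assms v]
      by (rule bounded_linear_imp_has_derivative[OF bounded_linear_vector_scalar_mult_left])
    ultimately have "(\<lambda>t. L (t *s v)) = (\<lambda>t. t *s \<phi> v)"
      by (rule has_derivative_unique)
    from fun_cong[OF this, of 1] show ?thesis by simp
  qed
  obtain \<epsilon> where \<epsilon>: "\<epsilon> > 0" "ball 0 \<epsilon> \<subseteq> Dom a m"
    using open_Dom zero_in by (meson openE)
  \<comment> \<open>The Euclidean norm is at most the sum of the coordinate moduli, here at most
    \<open>\<epsilon> / 2\<close>.\<close>
  define r where "r = \<epsilon> / (2 * CARD('n))"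
  have r: "r > 0" using \<epsilon> by (simp add: r_def)
  have polydisc: "z \<in> Dom a m" if "\<forall>k. cmod (z $ k) \<le> r" for z :: "complex^'n"
  proof -
    have "norm z \<le> (\<Sum>k\<in>UNIV. cmod (z $ k))" unfolding norm_vec_def by (rule L2_set_le_sum) auto
    also have "\<dots> \<le> (\<Sum>k\<in>(UNIV::'n set). r)" using that by (intro sum_mono) auto
    also have "\<dots> < \<epsilon>" using \<epsilon> by (simp add: r_def)
    finally show ?thesis using \<epsilon>(2) by auto
  qed
  have "\<phi> z $ k = L z $ k" if z: "z \<in> Dom a m" for z k
  proof -
    define h where "h w = \<phi> w $ k - L w $ k" for w
    have hol: "(\<lambda>t. h (p + t *s q)) field_differentiable (at t)" if "p + t *s q \<in> Dom a m" for p q t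
      unfolding h_def Ladd L(2)
      using holo_Cn_line[OF holo that, of k]
      by (intro field_differentiable_diff) (auto intro!: derivative_intros)
    have torus0: "h w = 0" if w: "\<forall>i. cmod (w $ i) = r" for w
    proof -
      \<comment> \<open>Dividing by the distinguished coordinate puts \<open>w\<close> on a torus
        line.\<close>
      define v where "v = (\<chi> i. w $ i / w $ m)"
      have "w $ m \<noteq> 0" using w r by (metis norm_zero less_irrefl)
      then have "v \<in> torus m" "w = w $ m *s v"
        using w r by (auto simp: v_def torus_def norm_divide vec_eq_iff)
      then have "L w = \<phi> w"
        using L(2)[of "w $ m" v] Ltorus automorphism_homogeneous_on_torus[OF assms] by metis
      then show ?thesis by (simp add: h_def)
    qed
    have poly0: "h w = 0" if "\<forall>i. cmod (w $ i) \<le> r" for w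
      using vanishing_on_polydisc[of r h w] hol polydisc torus0 that by blast
    have "open ((\<lambda>t. t *s z) -` Dom a m)"
      by (intro open_vimage open_Dom linear_continuous_on bounded_linear_vector_scalar_mult_left)
    moreover have "1 \<in> (\<lambda>t. t *s z) -` Dom a m" using z by simp
    ultimately obtain \<delta> where \<delta>: "\<delta> > 0" "ball 1 \<delta> \<subseteq> (\<lambda>t. t *s z) -` Dom a m"
      by (meson openE)
    \<comment> \<open>A radius above 1 puts \<open>t = 1\<close> inside the disc; as
      \<open>R z\<close> still lies in the balanced domain, so does \<open>t z\<close> for all
      \<open>t\<close> of the disc.\<close>
    define R where "R = 1 + \<delta> / 2"
    have "complex_of_real R \<in> ball 1 \<delta>" using \<delta>(1) by (simp add: R_def dist_norm)
    then have Rz: "of_real R *s z \<in> Dom a m" using \<delta>(2) by blast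
    have R: "R > 1" using \<delta> by (simp add: R_def)
    have inD: "t *s z \<in> Dom a m" if "t \<in> ball 0 R" for t
    proof -
      have "(t / of_real R) *s (of_real R *s z) \<in> Dom a m"
        using that R by (intro balanced_Dom a Rz) (simp add: norm_divide)
      then show ?thesis using R by simp
    qed
    \<comment> \<open>For \<open>|t| < \<eta>\<close> every coordinate of \<open>t z\<close> has
      modulus at most \<open>r\<close>, so \<open>t z\<close> lies in the polydisc.\<close>
    define \<eta> where "\<eta> = r / (norm z + 1)"
    have \<eta>: "\<eta> > 0" using r by (simp add: \<eta>_def add_nonneg_pos)
    have "h (1 *s z) = 0"
    proof (rule analytic_continuation[where f = "\<lambda>t. h (t *s z)" and S = "ball 0 R"
          and U = "ball 0 (min R \<eta>)" and \<xi> = 0])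
      show "(\<lambda>t. h (t *s z)) holomorphic_on ball 0 R"
        unfolding holomorphic_on_def
      proof
        fix t :: complex assume "t \<in> ball 0 R"
        then show "(\<lambda>t. h (t *s z)) field_differentiable at t within ball 0 R"
          using field_differentiable_at_within[OF hol[of 0 t z]] inD by simp
      qed
      show "(0::complex) islimpt ball 0 (min R \<eta>)" using R \<eta> by (simp add: islimpt_ball)
      show "h (t *s z) = 0" if t: "t \<in> ball 0 (min R \<eta>)" for t
      proof (rule poly0, rule allI)
        fix i
        have "cmod ((t *s z) $ i) \<le> \<eta> * (norm z + 1)"
          unfolding vector_smult_component norm_mult
          using t Finite_Cartesian_Product.norm_nth_le[of z i] \<eta> by (intro mult_mono) auto
        also have "\<dots> = r" by (simp add: \<eta>_def add_nonneg_eq_0_iff)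
        finally show "cmod ((t *s z) $ i) \<le> r" .
      qed
    qed (use R in auto)
    then show ?thesis by (simp add: h_def)
  qed
  then have "\<phi> z = L z" if "z \<in> Dom a m" for z using that by (simp add: vec_eq_iff)
  moreover have "Vector_Spaces.linear (*s) (*s) L"
    by unfold_locales (auto simp: Ladd L(2) algebra_simps)
  ultimately show ?thesis using that by blast
qed

theorem theorem4p3:
  fixes a :: real and m :: "'n::finite" and \<phi> :: "complex^'n \<Rightarrow> complex^'n"
  assumes "CARD('n) \<ge> 2"
    and "2 / (real CARD('n) - 1) < a" and "a \<le> 3 / (real CARD('n) - 1)"
    and "\<phi> \<in> Aut (Dom a m)"
  shows "\<exists>A :: complex^'n^'n. \<forall>z\<in>Dom a m. \<phi> z = A *v z"
proof -
  \<comment> \<open>The lower bound on \<open>a\<close> is nonnegative for \<open>n >= 2\<close>,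
    whence \<open>a > 0\<close>.\<close>
  have "0 \<le> 2 / (real CARD('n) - 1)" using assms(1) by simp
  with assms(2) have "a > 0" by linarith
  then obtain L where "Vector_Spaces.linear (*s) (*s) L" "\<And>z. z \<in> Dom a m \<Longrightarrow> \<phi> z = L z"
    using automorphism_linear[OF assms(1) _ assms(4)] by blast
  then have "\<forall>z\<in>Dom a m. \<phi> z = matrix L *v z" by (simp add: matrix_works)
  then show ?thesis by blast
qed

end
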